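(* Let $G$ and $H$ be sequent calculi such that $G$ is a set of strongly focused axioms, $H$ extends $\mathbf{MALL}$, and every sequent of $G$ is provable in $H$. Then $G$ has $H$-monotone feasible interpolation.
   Context: Language: classical propositional language with fusion, addition, $1$, $0$ read as $\wedge,\vee,\top,\bot$; $V(\cdot)$ = atoms (for meta-formulas also formula variables). Multi-conclusion sequents $\Gamma\Rightarrow\Delta$ with finite multisets. $\mathbf{MALL}$: multi-conclusion calculus with axioms $\phi\Rightarrow\phi$, $\Rightarrow1$, $0\Rightarrow$, $\Gamma\Rightarrow\top,\Delta$, $\Gamma,\bot\Rightarrow\Delta$ and the standard multi-conclusion rules for $1,0,\wedge,\vee,*,+$ (i.e. $\mathbf{CFL_e}$ without implication rules); $H$ extends $\mathbf{MALL}$ if every $\mathbf{MALL}$-provable sequent is $H$-provable. Strongly focused axioms: $\phi\Rightarrow\phi$; $\Rightarrow\bar\alpha$; $\bar\beta\Rightarrow$; $\Gamma,\bar\phi\Rightarrow\Delta$; $\Gamma\Rightarrow\bar\phi,\Delta$, where $\bar\alpha$ (second form) and $\bar\phi$ (fifth form) contain no variables, and $\Gamma,\Delta$ are meta-multiset variables. A formula is monotone if all atom occurrences are positive (not under negation nor in the antecedent of an implication); a multiset is monotone if all its elements are. $G$ has $H$-monotone feasible interpolation if for every $k$ and every sequent $\Sigma\Rightarrow\Lambda_1,\dots,\Lambda_k$ (succedent split into multisets $\Lambda_j$) with a tree-like $G$-proof $\pi$ there are formulas $C_1,\dots,C_k$ with $|C_j|\le|\pi|^{O(1)}$, $H\vdash\Sigma\Rightarrow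 C_1,\dots,C_k$, $H\vdash C_j\Rightarrow\Lambda_j$, $V(C_j)\subseteq V(\Sigma)\cap V(\Lambda_j)$, and each $C_j$ monotone whenever $\Sigma$ is monotone.
   Formalization: "H extends MALL" is strengthened: the H-provable sequents must also be closed under the MALL rules; with mere inclusion of MALL-provable sequents the claim fails (e.g. G = {p ⇒}, H = all MALL-provable sequents plus p ⇒ as axioms, without rules). *)

theory Defs
  imports "HOL-Library.Multiset"
begin

text \<open>
  Connectives carry a mode. With two distinct modes one obtains the language with
  \<open>\<and>, \<or>, \<top>, \<bottom>\<close> (additive) and \<open>*, +, 1, 0\<close> (multiplicative) as separate symbols. With a single
  mode one obtains the plain classical language, in which \<open>*, +, 1, 0\<close> are literally read as
  \<open>\<and>, \<or>, \<top>, \<bottom>\<close>. Everything below is uniform in the two readings.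
\<close>

class mode =
  fixes additive :: 'a and multiplicative :: 'a
  assumes modes: "UNIV = {additive, multiplicative}"

datatype two_modes = Additive | Multiplicative

instantiation two_modes :: mode
begin
definition "additive = Additive"
definition "multiplicative = Multiplicative"
instance
  by standard
    (metis UNIV_eq_I additive_two_modes_def insertI1 insert_subset
      multiplicative_two_modes_def subset_insertI two_modes.exhaust)
end

instantiation unit :: mode
begin
definition "additive = ()"
definition "multiplicative = ()"
instance by standard auto
end

datatype ('a, 'm) fm =
    Atom 'a
  | TopM 'm
  | BotM 'm
  | Neg "('a, 'm) fm"
  | ConM 'm "('a, 'm) fm" "('a, 'm) fm"
  | DisM 'm "('a, 'm) fm" "('a, 'm) fm"
  | Imp "('a, 'm) fm" "('a, 'm) fm"

abbreviation Top :: "('a, 'm::mode) fm" where "Top \<equiv> TopM additive"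
abbreviation Bot :: "('a, 'm::mode) fm" where "Bot \<equiv> BotM additive"
abbreviation One :: "('a, 'm::mode) fm" where "One \<equiv> TopM multiplicative"
abbreviation Zero :: "('a, 'm::mode) fm" where "Zero \<equiv> BotM multiplicative"
abbreviation And :: "('a, 'm::mode) fm \<Rightarrow> ('a, 'm) fm \<Rightarrow> ('a, 'm) fm"
  where "And \<equiv> ConM additive"
abbreviation Or :: "('a, 'm::mode) fm \<Rightarrow> ('a, 'm) fm \<Rightarrow> ('a, 'm) fm"
  where "Or \<equiv> DisM additive"
abbreviation Fusion :: "('a, 'm::mode) fm \<Rightarrow> ('a, 'm) fm \<Rightarrow> ('a, 'm) fm"
  where "Fusion \<equiv> ConM multiplicative"
abbreviation Plus :: "('a, 'm::mode) fm \<Rightarrow> ('a, 'm) fm \<Rightarrow> ('a, 'm) fm"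
  where "Plus \<equiv> DisM multiplicative"

primrec V :: "('a, 'm) fm \<Rightarrow> 'a set" where
  "V (Atom p) = {p}"
| "V (TopM m) = {}"
| "V (BotM m) = {}"
| "V (Neg A) = V A"
| "V (ConM m A B) = V A \<union> V B"
| "V (DisM m A B) = V A \<union> V B"
| "V (Imp A B) = V A \<union> V B"

definition V_mset :: "('a, 'm) fm multiset \<Rightarrow> 'a set" where
  "V_mset \<Gamma> = (\<Union>A\<in>set_mset \<Gamma>. V A)"

primrec fm_size :: "('a, 'm) fm \<Rightarrow> nat" where
  "fm_size (Atom p) = 1"
| "fm_size (TopM m) = 1"
| "fm_size (BotM m) = 1"
| "fm_size (Neg A) = fm_size A + 1"
| "fm_size (ConM m A B) = fm_size A + fm_size B + 1"
| "fm_size (DisM m A B) = fm_size A + fm_size B + 1"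
| "fm_size (Imp A B) = fm_size A + fm_size B + 1"

text \<open>No atom occurs under a negation or in the antecedent of an implication.\<close>

primrec monotone_fm :: "('a, 'm) fm \<Rightarrow> bool" where
  "monotone_fm (Atom p) \<longleftrightarrow> True"
| "monotone_fm (TopM m) \<longleftrightarrow> True"
| "monotone_fm (BotM m) \<longleftrightarrow> True"
| "monotone_fm (Neg A) \<longleftrightarrow> V A = {}"
| "monotone_fm (ConM m A B) \<longleftrightarrow> monotone_fm A \<and> monotone_fm B"
| "monotone_fm (DisM m A B) \<longleftrightarrow> monotone_fm A \<and> monotone_fm B"
| "monotone_fm (Imp A B) \<longleftrightarrow> V A = {} \<and> monotone_fm B"

definition monotone_mset :: "('a, 'm) fm multiset \<Rightarrow> bool" where
  "monotone_mset \<Gamma> \<longleftrightarrow> (\<forall>A\<in>#\<Gamma>. monotone_fm A)"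

type_synonym 'f sequent = "'f multiset \<times> 'f multiset"

abbreviation (input) Sequent :: "'f multiset \<Rightarrow> 'f multiset \<Rightarrow> 'f sequent" (infix "\<leadsto>" 55)
  where "\<Gamma> \<leadsto> \<Delta> \<equiv> (\<Gamma>, \<Delta>)"

type_synonym 'm form = "(nat, 'm) fm"

text \<open>
  Meta-formulas are built from atoms and formula variables, so \<^const>\<open>V\<close> of a meta-formula collects
  both. Meta-sequents may in addition contain meta-multiset variables (\<open>Ctx\<close>).
\<close>

datatype meta_atom = PAtom nat | FVar nat

type_synonym 'm meta_form = "(meta_atom, 'm) fm"

datatype 'm meta_item = Fm "'m meta_form" | Ctx nat

type_synonym 'm meta_sequent = "'m meta_item sequent"

primrec subst_fm :: "(nat \<Rightarrow> 'm form) \<Rightarrow> 'm meta_form \<Rightarrow> 'm form" where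
  "subst_fm \<sigma> (Atom a) = (case a of PAtom p \<Rightarrow> Atom p | FVar x \<Rightarrow> \<sigma> x)"
| "subst_fm \<sigma> (TopM m) = TopM m"
| "subst_fm \<sigma> (BotM m) = BotM m"
| "subst_fm \<sigma> (Neg A) = Neg (subst_fm \<sigma> A)"
| "subst_fm \<sigma> (ConM m A B) = ConM m (subst_fm \<sigma> A) (subst_fm \<sigma> B)"
| "subst_fm \<sigma> (DisM m A B) = DisM m (subst_fm \<sigma> A) (subst_fm \<sigma> B)"
| "subst_fm \<sigma> (Imp A B) = Imp (subst_fm \<sigma> A) (subst_fm \<sigma> B)"

primrec inst_item ::
  "(nat \<Rightarrow> 'm form) \<Rightarrow> (nat \<Rightarrow> 'm form multiset) \<Rightarrow> 'm meta_item \<Rightarrow> 'm form multiset" where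
  "inst_item \<sigma> \<tau> (Fm A) = {#subst_fm \<sigma> A#}"
| "inst_item \<sigma> \<tau> (Ctx X) = \<tau> X"

definition inst ::
  "(nat \<Rightarrow> 'm form) \<Rightarrow> (nat \<Rightarrow> 'm form multiset) \<Rightarrow> 'm meta_sequent \<Rightarrow> 'm form sequent" where
  "inst \<sigma> \<tau> S =
    (\<Sum>\<^sub># (image_mset (inst_item \<sigma> \<tau>) (fst S)) \<leadsto> \<Sum>\<^sub># (image_mset (inst_item \<sigma> \<tau>) (snd S)))"

text \<open>A rule is a list of premises with a conclusion; axioms are the rules without premises.\<close>

type_synonym 'm rule = "'m meta_sequent list \<times> 'm meta_sequent"
type_synonym 'm calculus = "'m rule set"

datatype 'm proof_tree = Node (root: "'m form sequent") "'m proof_tree list"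

fun is_proof :: "'m calculus \<Rightarrow> 'm proof_tree \<Rightarrow> bool" where
  "is_proof G (Node S ts) \<longleftrightarrow>
    (\<exists>(ps, c)\<in>G. \<exists>\<sigma> \<tau>. S = inst \<sigma> \<tau> c \<and> map root ts = map (inst \<sigma> \<tau>) ps) \<and>
    (\<forall>t\<in>set ts. is_proof G t)"

definition provable :: "'m calculus \<Rightarrow> 'm form sequent \<Rightarrow> bool" (infix "\<turnstile>" 50) where
  "G \<turnstile> S \<longleftrightarrow> (\<exists>\<pi>. is_proof G \<pi> \<and> root \<pi> = S)"

text \<open>Number of symbols, the sequent arrow included.\<close>

definition sequent_size :: "('a, 'm) fm sequent \<Rightarrow> nat" where
  "sequent_size S = 1 + (\<Sum>A\<in>#fst S. fm_size A) + (\<Sum>A\<in>#snd S. fm_size A)"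

fun proof_size :: "'m proof_tree \<Rightarrow> nat" where
  "proof_size (Node S ts) = sequent_size S + sum_list (map proof_size ts)"

definition MALL :: "'m::mode calculus" where
  "MALL =
    (let A = Atom (FVar 0); B = Atom (FVar 1);
         \<Gamma> = Ctx 0; \<Delta> = Ctx 1; \<Gamma>' = Ctx 2; \<Delta>' = Ctx 3
     in {
      ([], {#Fm A#} \<leadsto> {#Fm A#}),
      ([], {#} \<leadsto> {#Fm One#}),
      ([], {#Fm Zero#} \<leadsto> {#}),
      ([], {#\<Gamma>#} \<leadsto> {#Fm Top, \<Delta>#}),
      ([], {#\<Gamma>, Fm Bot#} \<leadsto> {#\<Delta>#}),
      ([{#\<Gamma>#} \<leadsto> {#\<Delta>#}], {#\<Gamma>, Fm One#} \<leadsto> {#\<Delta>#}),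
      ([{#\<Gamma>#} \<leadsto> {#\<Delta>#}], {#\<Gamma>#} \<leadsto> {#Fm Zero, \<Delta>#}),
      ([{#\<Gamma>, Fm A#} \<leadsto> {#\<Delta>#}], {#\<Gamma>, Fm (And A B)#} \<leadsto> {#\<Delta>#}),
      ([{#\<Gamma>, Fm B#} \<leadsto> {#\<Delta>#}], {#\<Gamma>, Fm (And A B)#} \<leadsto> {#\<Delta>#}),
      ([{#\<Gamma>#} \<leadsto> {#Fm A, \<Delta>#}, {#\<Gamma>#} \<leadsto> {#Fm B, \<Delta>#}], {#\<Gamma>#} \<leadsto> {#Fm (And A B), \<Delta>#}),
      ([{#\<Gamma>, Fm A#} \<leadsto> {#\<Delta>#}, {#\<Gamma>, Fm B#} \<leadsto> {#\<Delta>#}], {#\<Gamma>, Fm (Or A B)#} \<leadsto> {#\<Delta>#}),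
      ([{#\<Gamma>#} \<leadsto> {#Fm A, \<Delta>#}], {#\<Gamma>#} \<leadsto> {#Fm (Or A B), \<Delta>#}),
      ([{#\<Gamma>#} \<leadsto> {#Fm B, \<Delta>#}], {#\<Gamma>#} \<leadsto> {#Fm (Or A B), \<Delta>#}),
      ([{#\<Gamma>, Fm A, Fm B#} \<leadsto> {#\<Delta>#}], {#\<Gamma>, Fm (Fusion A B)#} \<leadsto> {#\<Delta>#}),
      ([{#\<Gamma>#} \<leadsto> {#Fm A, \<Delta>#}, {#\<Gamma>'#} \<leadsto> {#Fm B, \<Delta>'#}],
        {#\<Gamma>, \<Gamma>'#} \<leadsto> {#Fm (Fusion A B), \<Delta>, \<Delta>'#}),
      ([{#\<Gamma>, Fm A#} \<leadsto> {#\<Delta>#}, {#\<Gamma>', Fm B#} \<leadsto> {#\<Delta>'#}],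
        {#\<Gamma>, \<Gamma>', Fm (Plus A B)#} \<leadsto> {#\<Delta>, \<Delta>'#}),
      ([{#\<Gamma>#} \<leadsto> {#Fm A, Fm B, \<Delta>#}], {#\<Gamma>#} \<leadsto> {#Fm (Plus A B), \<Delta>#}) })"

text \<open>
  As \<open>H\<close> need not contain any rules beyond its axioms, preservation of provable sequents must be
  understood relative to \<open>H\<close>: whatever the rules of \<open>M\<close> yield from \<open>H\<close>-provable sequents is
  \<open>H\<close>-provable. This is admissibility, not derivability, of the rules of \<open>M\<close>, and it does not ask
  for cut. The first conjunct is the absolute version and is implied by the second.
\<close>

definition extends :: "'m calculus \<Rightarrow> 'm calculus \<Rightarrow> bool" where
  "extends H M \<longleftrightarrow>
    (\<forall>S. M \<turnstile> S \<longrightarrow> H \<turnstile> S) \<and>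
    (\<forall>(ps, c)\<in>M. \<forall>\<sigma> \<tau>. (\<forall>p\<in>set ps. H \<turnstile> inst \<sigma> \<tau> p) \<longrightarrow> H \<turnstile> inst \<sigma> \<tau> c)"

inductive strongly_focused :: "'m meta_sequent \<Rightarrow> bool" where
  "strongly_focused ({#Fm A#} \<leadsto> {#Fm A#})"
| "V_mset \<alpha> = {} \<Longrightarrow> strongly_focused ({#} \<leadsto> image_mset Fm \<alpha>)"
| "strongly_focused (image_mset Fm \<beta> \<leadsto> {#})"
| "\<Gamma> \<noteq> \<Delta> \<Longrightarrow> strongly_focused (add_mset (Ctx \<Gamma>) (image_mset Fm \<phi>) \<leadsto> {#Ctx \<Delta>#})"
| "\<Gamma> \<noteq> \<Delta> \<Longrightarrow> V_mset \<phi> = {} \<Longrightarrow>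
    strongly_focused ({#Ctx \<Gamma>#} \<leadsto> add_mset (Ctx \<Delta>) (image_mset Fm \<phi>))"

definition strongly_focused_axioms :: "'m calculus \<Rightarrow> bool" where
  "strongly_focused_axioms G \<longleftrightarrow> (\<forall>(ps, c)\<in>G. ps = [] \<and> strongly_focused c)"

text \<open>The exponent \<open>e\<close> is uniform in \<open>k\<close>, the sequent and the proof (it may depend on \<open>G\<close>, \<open>H\<close>).\<close>

definition monotone_feasible_interpolation :: "'m calculus \<Rightarrow> 'm calculus \<Rightarrow> bool" where
  "monotone_feasible_interpolation G H \<longleftrightarrow>
    (\<exists>e. \<forall>k \<Sigma> \<Lambda> \<pi>. length \<Lambda> = k \<and> is_proof G \<pi> \<and> root \<pi> = (\<Sigma> \<leadsto> sum_list \<Lambda>) \<longrightarrow>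
      (\<exists>C. length C = k \<and>
        (\<forall>j<k. fm_size (C ! j) \<le> proof_size \<pi> ^ e) \<and>
        H \<turnstile> (\<Sigma> \<leadsto> mset C) \<and>
        (\<forall>j<k. H \<turnstile> ({#C ! j#} \<leadsto> \<Lambda> ! j)) \<and>
        (\<forall>j<k. V (C ! j) \<subseteq> V_mset \<Sigma> \<inter> V_mset (\<Lambda> ! j)) \<and>
        (monotone_mset \<Sigma> \<longrightarrow> (\<forall>j<k. monotone_fm (C ! j)))))"

end

theory Submission
  imports Defs
begin

text \<open>
  Every strongly focused axiom has the form \<open>\<Sigma> \<Rightarrow> M, N\<close>, where the atoms of \<open>M\<close> occur in \<open>\<Sigma>\<close> and
  \<open>N\<close> is either empty or an instance of a meta-multiset variable, hence replaceable by anything.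
  Distribute \<open>M\<close> over the \<open>\<Lambda>\<^sub>j\<close> as \<open>\<Phi>\<^sub>j\<close> and let \<open>C\<^sub>j\<close> be the multiplicative disjunction of \<open>\<Phi>\<^sub>j\<close> and a
  final disjunct \<open>Z\<close>, where \<open>Z = 0\<close> if \<open>N\<close> is empty and \<open>Z = \<bottom>\<close> otherwise. In the second case
  \<open>\<bottom>\<close> absorbs the part of \<open>N\<close> in \<open>\<Lambda>\<^sub>j\<close>, which compensates for the missing weakening.
\<close>

section \<open>Rules of \<open>MALL\<close> acting on \<open>H\<close>-provable sequents\<close>

lemma extends_rule:
  assumes "extends H M" "(ps, c) \<in> M" "list_all (\<lambda>p. H \<turnstile> inst \<sigma> \<tau> p) ps"
  shows "H \<turnstile> inst \<sigma> \<tau> c"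
  using assms unfolding extends_def list_all_iff by blast

context
  fixes H :: "'m::mode calculus"
  assumes ext: "extends H MALL"
begin

lemma provable_refl: "H \<turnstile> ({#A#} \<leadsto> {#A#})"
  using extends_rule[OF ext, of "[]" "{#Fm (Atom (FVar 0))#} \<leadsto> {#Fm (Atom (FVar 0))#}" "\<lambda>_. A"]
  by (simp add: MALL_def Let_def inst_def)

lemma provable_ZeroL: "H \<turnstile> ({#Zero#} \<leadsto> {#})"
  using extends_rule[OF ext, of "[]" "{#Fm Zero#} \<leadsto> {#}"]
  by (simp add: MALL_def Let_def inst_def)

lemma provable_BotL: "H \<turnstile> ({#Bot#} \<leadsto> \<Delta>)"
  using extends_rule[OF ext, of "[]" "{#Ctx 0, Fm Bot#} \<leadsto> {#Ctx 1#}" _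
      "\<lambda>n. if n = 0 then {#} else \<Delta>"]
  by (simp add: MALL_def Let_def inst_def)

lemma provable_ZeroR:
  assumes "H \<turnstile> (\<Gamma> \<leadsto> \<Delta>)"
  shows "H \<turnstile> (\<Gamma> \<leadsto> add_mset Zero \<Delta>)"
  using extends_rule[OF ext, of "[{#Ctx 0#} \<leadsto> {#Ctx 1#}]" "{#Ctx 0#} \<leadsto> {#Fm Zero, Ctx 1#}" _
      "\<lambda>n. if n = 0 then \<Gamma> else \<Delta>"] assms
  by (simp add: MALL_def Let_def inst_def)

lemma provable_PlusL:
  assumes "H \<turnstile> ({#A#} \<leadsto> \<Delta>)" "H \<turnstile> ({#B#} \<leadsto> \<Delta>')"
  shows "H \<turnstile> ({#Plus A B#} \<leadsto> \<Delta> + \<Delta>')"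
  using extends_rule[OF ext, of
      "[{#Ctx 0, Fm (Atom (FVar 0))#} \<leadsto> {#Ctx 1#}, {#Ctx 2, Fm (Atom (FVar 1))#} \<leadsto> {#Ctx 3#}]"
      "{#Ctx 0, Ctx 2, Fm (Plus (Atom (FVar 0)) (Atom (FVar 1)))#} \<leadsto> {#Ctx 1, Ctx 3#}"
      "\<lambda>n. if n = 0 then A else B"
      "\<lambda>n. if n = 1 then \<Delta> else if n = 3 then \<Delta>' else {#}"] assms
  by (simp add: MALL_def Let_def inst_def add_mset_commute)

lemma provable_PlusR:
  assumes "H \<turnstile> (\<Gamma> \<leadsto> add_mset A (add_mset B \<Delta>))"
  shows "H \<turnstile> (\<Gamma> \<leadsto> add_mset (Plus A B) \<Delta>)"
  using extends_rule[OF ext, of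
      "[{#Ctx 0#} \<leadsto> {#Fm (Atom (FVar 0)), Fm (Atom (FVar 1)), Ctx 1#}]"
      "{#Ctx 0#} \<leadsto> {#Fm (Plus (Atom (FVar 0)) (Atom (FVar 1))), Ctx 1#}"
      "\<lambda>n. if n = 0 then A else B" "\<lambda>n. if n = 0 then \<Gamma> else \<Delta>"] assms
  by (simp add: MALL_def Let_def inst_def add_mset_commute)

text \<open>Without weakening, \<open>0\<close> can still be added on the right freely; this pays
  for the final disjuncts \<open>Zero\<close> of all interpolants at once.\<close>

lemma provable_ZeroR_replicate:
  "H \<turnstile> (\<Gamma> \<leadsto> \<Delta>) \<Longrightarrow> H \<turnstile> (\<Gamma> \<leadsto> \<Delta> + replicate_mset n Zero)"
  by (induction n) (auto intro: provable_ZeroR)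

text \<open>The left rule for \<open>+\<close> splits the succedent: each disjunct \<open>x\<close>
  is closed by its own \<open>x \<Rightarrow> x\<close>, and \<open>\<Delta>\<close> is left to
  \<open>Z\<close>. This yields \<open>C\<^sub>j \<Rightarrow> \<Lambda>\<^sub>j\<close>.\<close>

lemma provable_foldr_PlusL:
  "H \<turnstile> ({#Z#} \<leadsto> \<Delta>) \<Longrightarrow> H \<turnstile> ({#foldr Plus xs Z#} \<leadsto> mset xs + \<Delta>)"
proof (induction xs)
  case (Cons x xs)
  then show ?case
    using provable_PlusL[OF provable_refl[of x] Cons.IH] by simp
qed simp

lemma provable_foldr_PlusR:
  "H \<turnstile> (\<Gamma> \<leadsto> mset xs + add_mset Z \<Delta>) \<Longrightarrow> H \<turnstile> (\<Gamma> \<leadsto> add_mset (foldr Plus xs Z) \<Delta>)"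
proof (induction xs arbitrary: \<Delta>)
  case (Cons x xs)
  \<comment> \<open>The tail is folded first, with \<open>x\<close> parked in the context; hence the
    induction over arbitrary \<open>\<Delta>\<close>.\<close>
  have "H \<turnstile> (\<Gamma> \<leadsto> add_mset (foldr Plus xs Z) (add_mset x \<Delta>))"
    using Cons.prems by (intro Cons.IH) (simp add: add_mset_commute)
  then show ?case
    by (simp add: add_mset_commute provable_PlusR)
qed simp

text \<open>Builds all interpolants on the right of one sequent. Each fold consumes its own copy of
  \<open>Z\<close>, so one copy per list is required.\<close>

lemma provable_foldr_PlusR_list:
  assumes "H \<turnstile> (\<Gamma> \<leadsto> sum_list (map mset xss) + replicate_mset (length xss) Z + \<Delta>)"
  shows "H \<turnstile> (\<Gamma> \<leadsto> mset (map (\<lambda>xs. foldr Plus xs Z) xss) + \<Delta>)"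
  using assms
proof (induction xss arbitrary: \<Delta>)
  case (Cons xs xss)
  have "H \<turnstile> (\<Gamma> \<leadsto> mset (map (\<lambda>xs. foldr Plus xs Z) xss) + (mset xs + add_mset Z \<Delta>))"
    using Cons.prems by (intro Cons.IH) (simp add: ac_simps)
  then have "H \<turnstile> (\<Gamma> \<leadsto> mset xs + add_mset Z (mset (map (\<lambda>xs. foldr Plus xs Z) xss) + \<Delta>))"
    by (simp add: ac_simps)
  from provable_foldr_PlusR[OF this] show ?case
    by simp
qed simp

end

section \<open>Atoms, monotonicity and size of iterated disjunctions; closed formulas\<close>

lemma V_foldr_DisM: "V (foldr (DisM m) xs Z) = V_mset (mset xs) \<union> V Z"
  by (induction xs) (auto simp: V_mset_def)

lemma monotone_foldr_DisM:
  "monotone_fm (foldr (DisM m) xs Z) \<longleftrightarrow> monotone_mset (mset xs) \<and> monotone_fm Z"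
  by (induction xs) (auto simp: monotone_mset_def)

lemma fm_size_pos: "0 < fm_size A"
  by (cases A) auto

text \<open>Each disjunct brings one connective, and its own size is at least 1, so doubling absorbs
  the connectives.\<close>

lemma fm_size_foldr_DisM:
  "fm_size (foldr (DisM m) xs Z) \<le> 2 * (\<Sum>A\<in>#mset xs. fm_size A) + fm_size Z"
proof (induction xs)
  case (Cons x xs)
  then show ?case using fm_size_pos[of x] by simp
qed simp

lemma monotone_closed: "V A = {} \<Longrightarrow> monotone_fm A"
  by (induction A) auto

lemma V_mset_mono: "M \<subseteq># N \<Longrightarrow> V_mset M \<subseteq> V_mset N"
  unfolding V_mset_def by (blast dest: mset_subset_eqD)

lemma subst_closed: "V A = {} \<Longrightarrow> V (subst_fm \<sigma> A) = {}"
  by (induction A) auto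

lemma inst_image_Fm:
  "\<Sum>\<^sub># (image_mset (inst_item \<sigma> \<tau>) (image_mset Fm \<alpha>)) = image_mset (subst_fm \<sigma>) \<alpha>"
  by (induction \<alpha>) auto

lemma V_mset_subst_closed: "V_mset \<alpha> = {} \<Longrightarrow> V_mset (image_mset (subst_fm \<sigma>) \<alpha>) = {}"
  by (auto simp: V_mset_def subst_closed)

lemma monotone_mset_closed: "V_mset \<alpha> = {} \<Longrightarrow> monotone_mset \<alpha>"
  by (auto simp: V_mset_def monotone_mset_def intro: monotone_closed)

section \<open>Construction of the interpolants from a split succedent\<close>

text \<open>Greedy distribution: each component in turn takes as much of the remaining
  \<open>M\<close> as it can, and its excess comes from \<open>N\<close>.\<close>

lemma mset_split_list:
  assumes "sum_list \<Lambda> = M + N"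
  shows "\<exists>\<Phi>. length \<Phi> = length \<Lambda> \<and> sum_list (map mset \<Phi>) = M \<and>
    (\<forall>j<length \<Lambda>. \<exists>\<Delta>. \<Lambda> ! j = mset (\<Phi> ! j) + \<Delta> \<and> \<Delta> \<subseteq># N)"
  using assms
proof (induction \<Lambda> arbitrary: M N)
  case (Cons L \<Lambda>)
  define A where "A = L \<inter># M"
  \<comment> \<open>If \<open>L\<close> has more copies of a formula than \<open>M\<close>, then
    \<open>A\<close> uses up those of \<open>M\<close>, so the surplus lies in
    \<open>N\<close>.\<close>
  have le: "L - A \<subseteq># N"
    using Cons.prems unfolding A_def
    by (metis diff_intersect_left_idem mset_subset_eq_add_left subset_eq_diff_conv sum_list.Cons
        add.commute)
  have "sum_list \<Lambda> = (M - A) + (N - (L - A))"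
  proof (rule multiset_eqI)
    fix x
    have "count L x + count (sum_list \<Lambda>) x = count M x + count N x"
      using arg_cong[OF Cons.prems, of "\<lambda>X. count X x"] by simp
    then show "count (sum_list \<Lambda>) x = count ((M - A) + (N - (L - A))) x"
      unfolding A_def by auto
  qed
  from Cons.IH[OF this] obtain \<Phi> where \<Phi>: "length \<Phi> = length \<Lambda>" "sum_list (map mset \<Phi>) = M - A"
    "\<forall>j<length \<Lambda>. \<exists>\<Delta>. \<Lambda> ! j = mset (\<Phi> ! j) + \<Delta> \<and> \<Delta> \<subseteq># N - (L - A)"
    by blast
  obtain xs where xs: "mset xs = A"
    using ex_mset by blast
  have "A \<subseteq># L" "A \<subseteq># M"
    by (simp_all add: A_def)
  show ?case
  proof (intro exI[of _ "xs # \<Phi>"] conjI allI impI)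
    fix j assume "j < length (L # \<Lambda>)"
    then show "\<exists>\<Delta>. (L # \<Lambda>) ! j = mset ((xs # \<Phi>) ! j) + \<Delta> \<and> \<Delta> \<subseteq># N"
    proof (cases j)
      case 0
      then show ?thesis using le xs \<open>A \<subseteq># L\<close> by (auto intro!: exI[of _ "L - A"])
    next
      case (Suc i)
      then show ?thesis
        using \<Phi>(3) \<open>j < length (L # \<Lambda>)\<close>
        by (auto dest!: spec[of _ i] subset_mset.order_trans[OF _ diff_subset_eq_self])
    qed
  qed (use \<Phi> xs \<open>A \<subseteq># M\<close> in auto)
qed simp

text \<open>Isolates what is asked of \<open>Z\<close>: it must entail every part of
  \<open>N\<close> that may fall into some \<open>\<Lambda>\<^sub>j\<close>, and one copy per
  \<open>\<Lambda>\<^sub>j\<close> must be admissible beside \<open>M\<close>.\<close>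

lemma interpolants:
  fixes H :: "'m::mode calculus"
  assumes ext: "extends H MALL"
    and \<Lambda>: "sum_list \<Lambda> = M + N"
    and Z: "V Z = {}" "fm_size Z = 1" "\<And>\<Delta>. \<Delta> \<subseteq># N \<Longrightarrow> H \<turnstile> ({#Z#} \<leadsto> \<Delta>)"
    and prov: "H \<turnstile> (\<Sigma> \<leadsto> M + replicate_mset (length \<Lambda>) Z)"
    and vars: "V_mset M \<subseteq> V_mset \<Sigma>"
    and mono: "monotone_mset \<Sigma> \<Longrightarrow> monotone_mset M"
    and size: "sequent_size (\<Sigma> \<leadsto> sum_list \<Lambda>) \<le> s"
  shows "\<exists>C. length C = length \<Lambda> \<and>
    (\<forall>j<length \<Lambda>. fm_size (C ! j) \<le> s ^ 2) \<and>
    H \<turnstile> (\<Sigma> \<leadsto> mset C) \<and>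
    (\<forall>j<length \<Lambda>. H \<turnstile> ({#C ! j#} \<leadsto> \<Lambda> ! j)) \<and>
    (\<forall>j<length \<Lambda>. V (C ! j) \<subseteq> V_mset \<Sigma> \<inter> V_mset (\<Lambda> ! j)) \<and>
    (monotone_mset \<Sigma> \<longrightarrow> (\<forall>j<length \<Lambda>. monotone_fm (C ! j)))"
proof -
  obtain \<Phi> where len: "length \<Phi> = length \<Lambda>" and M: "sum_list (map mset \<Phi>) = M"
    and split: "\<And>j. j < length \<Lambda> \<Longrightarrow> \<exists>\<Delta>. \<Lambda> ! j = mset (\<Phi> ! j) + \<Delta> \<and> \<Delta> \<subseteq># N"
    using mset_split_list[OF \<Lambda>] by blast
  define C where "C = map (\<lambda>xs. foldr Plus xs Z) \<Phi>"
  have C: "C ! j = foldr Plus (\<Phi> ! j) Z" if "j < length \<Lambda>" for j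
    using that len by (simp add: C_def)
  \<comment> \<open>Inclusion in \<open>M\<close> transfers the atom and monotonicity conditions
    relative to \<open>\<Sigma>\<close>; inclusion in \<open>\<Lambda> ! j\<close> below bounds the
    atoms on the other side.\<close>
  have sub: "mset (\<Phi> ! j) \<subseteq># M" if "j < length \<Lambda>" for j
    using that len M sum_list_map_remove1[of "\<Phi> ! j" \<Phi> mset]
    by (metis mset_subset_eq_add_left nth_mem)
  have sub': "mset (\<Phi> ! j) \<subseteq># \<Lambda> ! j" if "j < length \<Lambda>" for j
    using split[OF that] by auto
  show ?thesis
  proof (intro exI[of _ C] conjI allI impI)
    show "length C = length \<Lambda>" by (simp add: C_def len)
    show "H \<turnstile> (\<Sigma> \<leadsto> mset C)"
      using provable_foldr_PlusR_list[OF ext, of \<Sigma> \<Phi> Z "{#}"] prov M len by (simp add: C_def)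
  next
    fix j assume j: "j < length \<Lambda>"
    define a where "a = (\<Sum>A\<in>#mset (\<Phi> ! j). fm_size A)"
    obtain R where "M = mset (\<Phi> ! j) + R"
      using sub[OF j] by (metis subset_mset.add_diff_inverse)
    \<comment> \<open>The summand 1 is the sequent arrow. It makes the linear bound
      \<open>2 * a + 1\<close> fit under a square, also when \<open>a = 0\<close>.\<close>
    then have "1 + a \<le> s"
      using size unfolding \<Lambda> a_def by (simp add: sequent_size_def)
    have "fm_size (C ! j) \<le> 2 * a + 1"
      using fm_size_foldr_DisM[of multiplicative "\<Phi> ! j" Z] Z(2) C[OF j] by (simp add: a_def)
    also have "\<dots> \<le> (1 + a) ^ 2"
      by (simp add: power2_eq_square)
    also have "\<dots> \<le> s ^ 2"
      using \<open>1 + a \<le> s\<close> by (rule power_mono) simp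
    finally show "fm_size (C ! j) \<le> s ^ 2" .
  next
    fix j assume j: "j < length \<Lambda>"
    show "H \<turnstile> ({#C ! j#} \<leadsto> \<Lambda> ! j)"
      using split[OF j] provable_foldr_PlusL[OF ext Z(3)] by (auto simp: C[OF j])
  next
    fix j assume j: "j < length \<Lambda>"
    show "V (C ! j) \<subseteq> V_mset \<Sigma> \<inter> V_mset (\<Lambda> ! j)"
      using V_mset_mono[OF sub[OF j]] V_mset_mono[OF sub'[OF j]] vars
      by (auto simp: C[OF j] V_foldr_DisM Z(1))
  next
    fix j assume "monotone_mset \<Sigma>" and j: "j < length \<Lambda>"
    then show "monotone_fm (C ! j)"
      using mono mset_subset_eqD[OF sub[OF j]] monotone_closed[OF Z(1)]
      by (auto simp: C[OF j] monotone_foldr_DisM monotone_mset_def)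
  qed
qed

section \<open>The five axiom forms and the interpolation theorem\<close>

text \<open>Provability is assumed for all instances of \<open>c\<close>, not just the given one, so
  that a succedent context variable can be reinstantiated.\<close>

lemma strongly_focused_axiom_split:
  fixes H :: "'m::mode calculus"
  assumes "strongly_focused c"
    and ext: "extends H MALL"
    and prov: "\<And>\<sigma> \<tau>. H \<turnstile> inst \<sigma> \<tau> c"
    and "inst \<sigma> \<tau> c = (\<Sigma> \<leadsto> \<Lambda>)"
  obtains M N Z where "\<Lambda> = M + N" "V Z = {}" "fm_size Z = 1"
    "\<And>\<Delta>. \<Delta> \<subseteq># N \<Longrightarrow> H \<turnstile> ({#Z#} \<leadsto> \<Delta>)"
    "\<And>k. H \<turnstile> (\<Sigma> \<leadsto> M + replicate_mset k Z)"
    "V_mset M \<subseteq> V_mset \<Sigma>" "monotone_mset \<Sigma> \<Longrightarrow> monotone_mset M"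
proof -
  note result = that
  \<comment> \<open>Forms without context variables: the entire succedent is \<open>M\<close>, and
    the copies of \<open>Zero\<close> come from its right rule.\<close>
  have whole: thesis if "V_mset \<Lambda> \<subseteq> V_mset \<Sigma>" "monotone_mset \<Sigma> \<Longrightarrow> monotone_mset \<Lambda>"
  proof (rule result[of \<Lambda> "{#}" Zero])
    show "H \<turnstile> (\<Sigma> \<leadsto> \<Lambda> + replicate_mset k Zero)" for k
      using prov[of \<sigma> \<tau>] assms(4) by (simp add: provable_ZeroR_replicate[OF ext])
  qed (use that provable_ZeroL[OF ext] in auto)
  \<comment> \<open>Forms with a free context: taking copies of \<open>Bot\<close> as
    \<open>\<Delta>\<close> gives the sequent with \<open>Z = Bot\<close>, and closedness of
    \<open>M\<close> settles atoms and monotonicity.\<close>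
  have from_context: thesis if "\<Lambda> = M + N" "V_mset M = {}" "\<And>\<Delta>. H \<turnstile> (\<Sigma> \<leadsto> M + \<Delta>)" for M N
    by (rule result[of M N Bot])
      (use that provable_BotL[OF ext] monotone_mset_closed in auto)
  from assms(1) show thesis
  proof cases
    case (1 A)
    then show ?thesis using assms(4) by (intro whole) (auto simp: inst_def)
  next
    case (2 \<alpha>)
    then show ?thesis
      using assms(4) V_mset_subst_closed[of \<alpha> \<sigma>]
      by (intro whole) (auto simp: inst_def inst_image_Fm monotone_mset_closed)
  next
    case (3 \<beta>)
    then show ?thesis
      using assms(4) by (intro whole) (auto simp: inst_def V_mset_def monotone_mset_def)
  next
    case (4 \<Gamma> \<Delta> \<phi>)
    \<comment> \<open>Since \<open>\<Gamma> \<noteq> \<Delta>\<close>, changing the value of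
      \<open>\<Delta>\<close> leaves the antecedent \<open>\<Sigma>\<close> intact.\<close>
    have "H \<turnstile> (\<Sigma> \<leadsto> D)" for D
      using prov[of \<sigma> "\<tau>(\<Delta> := D)"] assms(4) 4 by (auto simp: inst_def inst_image_Fm)
    then show ?thesis by (intro from_context[of "{#}" \<Lambda>]) (auto simp: V_mset_def)
  next
    case (5 \<Gamma> \<Delta> \<phi>)
    have "H \<turnstile> (\<Sigma> \<leadsto> image_mset (subst_fm \<sigma>) \<phi> + D)" for D
      using prov[of \<sigma> "\<tau>(\<Delta> := D)"] assms(4) 5
      by (auto simp: inst_def inst_image_Fm add.commute)
    then show ?thesis
      using assms(4) 5 V_mset_subst_closed[of \<phi> \<sigma>]
      by (intro from_context[of "image_mset (subst_fm \<sigma>) \<phi>" "\<tau> \<Delta>"])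
        (auto simp: inst_def inst_image_Fm add.commute)
  qed
qed

theorem theorem5p12:
  fixes G H :: "'m::mode calculus"
  assumes "strongly_focused_axioms G"
    and "extends H MALL"
    and "\<forall>(ps, c)\<in>G. \<forall>\<sigma> \<tau>. H \<turnstile> inst \<sigma> \<tau> c"
  shows "monotone_feasible_interpolation G H"
  unfolding monotone_feasible_interpolation_def
\<comment> \<open>The exponent 2 is the quadratic bound from \<open>interpolants\<close>.\<close>
proof (intro exI[of _ 2] allI impI, elim conjE)
  fix k \<Sigma> \<Lambda> \<pi>
  assume k: "length \<Lambda> = k" and \<pi>: "is_proof G \<pi>" and root: "root \<pi> = (\<Sigma> \<leadsto> sum_list \<Lambda>)"
  obtain ts where node: "\<pi> = Node (\<Sigma> \<leadsto> sum_list \<Lambda>) ts"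
    using root by (cases \<pi>) auto
  \<comment> \<open>The root of the proof is already an instance of an axiom of \<open>G\<close>, so
    no induction on proofs occurs.\<close>
  obtain ps c \<sigma> \<tau> where c: "(ps, c) \<in> G" "inst \<sigma> \<tau> c = (\<Sigma> \<leadsto> sum_list \<Lambda>)"
    using \<pi> unfolding node by auto
  have "strongly_focused c" and prov: "\<And>\<sigma> \<tau>. H \<turnstile> inst \<sigma> \<tau> c"
    using assms(1,3) c(1) unfolding strongly_focused_axioms_def by auto
  from strongly_focused_axiom_split[OF this(1) assms(2) prov c(2)]
  obtain M N Z where *: "sum_list \<Lambda> = M + N" "V Z = {}" "fm_size Z = 1"
    "\<And>\<Delta>. \<Delta> \<subseteq># N \<Longrightarrow> H \<turnstile> ({#Z#} \<leadsto> \<Delta>)"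
    "\<And>k. H \<turnstile> (\<Sigma> \<leadsto> M + replicate_mset k Z)"
    "V_mset M \<subseteq> V_mset \<Sigma>" "monotone_mset \<Sigma> \<Longrightarrow> monotone_mset M"
    by metis
  have "sequent_size (\<Sigma> \<leadsto> sum_list \<Lambda>) \<le> proof_size \<pi>"
    by (simp add: node)
  from interpolants[OF assms(2) *(1-4) *(5) *(6,7) this]
  show "\<exists>C. length C = k \<and>
        (\<forall>j<k. fm_size (C ! j) \<le> proof_size \<pi> ^ 2) \<and>
        H \<turnstile> (\<Sigma> \<leadsto> mset C) \<and>
        (\<forall>j<k. H \<turnstile> ({#C ! j#} \<leadsto> \<Lambda> ! j)) \<and>
        (\<forall>j<k. V (C ! j) \<subseteq> V_mset \<Sigma> \<inter> V_mset (\<Lambda> ! j)) \<and>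
        (monotone_mset \<Sigma> \<longrightarrow> (\<forall>j<k. monotone_fm (C ! j)))"
    unfolding k .
qed

end
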